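(* Let $d\ge3$, let $T_d$ be the $d$-regular directed tree, and let $k$ be an integer with $2\le k\le d-1$. If $p_k=1-p$ and $p_{k+1}=p$ with $p\in[0,1]$ (all other $p_i=0$), then $$\tilde\theta(T_d,{\bf p})>0\quad\text{if and only if}\quad p>\frac{d-k(k-1)}{2k}.$$ In particular, if $k(k-1)\le d<(k+1)k$, then for general ${\bf p}$: $p_0+\cdots+p_k=1$ implies $\tilde\theta(T_d,{\bf p})=0$, and $p_{k+1}+\cdots+p_d=1$ implies $\tilde\theta(T_d,{\bf p})>0$.
   Context: $T_d=(V,E,o)$ is the connected $d$-regular directed graph without cycles, with a fixed origin $o$: $E$ is symmetric ($(x,y)\in E$ iff $(y,x)\in E$), and the underlying undirected graph is the infinite $d$-regular tree. Let $L_x=\{y:(x,y)\in E\}$, so $|L_x|=d$. Let ${\bf p}=(p_0,\dots,p_d)$ with $p_i\ge0$ and $\sum_i p_i=1$. Configurations are $\omega\in\Omega=\prod_{x\in V}2^{L_x}$ with the $\sigma$-field generated by finite-dimensional cylinders; $P_{\bf p}$ is the product measure under which the states $\omega(x)\subset L_x$ are independent with $P_{\bf p}(\omega(x)=S)=p_{|S|}/\binom{d}{|S|}$ for $S\subset L_x$. Put $E_\omega=\{(x,y):x\in V,\ y\in\omega(x)\}$. Vertices $x,y$ are strongly connected if $x=y$ or there are $x=z_0,\dots,z_m=y$ such that for each $i$, both $(z_i,z_{i+1})\in E_\omega$ and $(z_{i+1},z_i)\in E_\omega$. $|\tilde C|$ is the number of vertices strongly connected to $o$, and $\tilde\theta(T_d,{\bf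 p})=P_{\bf p}(|\tilde C|=\infty)$. *)

theory Defs
  imports "HOL-Probability.Probability"
begin

text \<open>
  A \<open>d\<close>-regular directed tree is given by a vertex set and a symmetric edge relation. Both
  orientations of every edge are present, so a cycle means one of the underlying undirected
  graph: a loop or a closed path through at least three distinct vertices.
\<close>

definition has_cycle :: "'v rel \<Rightarrow> bool" where
  "has_cycle E \<longleftrightarrow>
     (\<exists>x. (x, x) \<in> E) \<or>
     (\<exists>zs. length zs \<ge> 3 \<and> distinct zs \<and>
        (\<forall>i < length zs. (zs ! i, zs ! (Suc i mod length zs)) \<in> E))"

definition regular_tree :: "nat \<Rightarrow> 'v set \<Rightarrow> 'v rel \<Rightarrow> bool" where
  "regular_tree d V E \<longleftrightarrow>
     E \<subseteq> V \<times> V \<and> sym E \<and>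
     (\<forall>x\<in>V. finite (E `` {x}) \<and> card (E `` {x}) = d) \<and>
     (\<forall>x\<in>V. \<forall>y\<in>V. (x, y) \<in> E\<^sup>*) \<and>
     \<not> has_cycle E"

text \<open>Only the entries \<open>p 0, \<dots>, p d\<close> are meaningful.\<close>

definition prob_vector :: "nat \<Rightarrow> (nat \<Rightarrow> real) \<Rightarrow> bool" where
  "prob_vector d p \<longleftrightarrow> (\<forall>i\<le>d. p i \<ge> 0) \<and> (\<Sum>i\<le>d. p i) = 1"

definition state_measure :: "nat \<Rightarrow> (nat \<Rightarrow> real) \<Rightarrow> 'v set \<Rightarrow> 'v set measure" where
  "state_measure d p L =
     point_measure (Pow L) (\<lambda>S. ennreal (p (card S) / real (d choose card S)))"

definition config_measure ::
    "nat \<Rightarrow> 'v set \<Rightarrow> 'v rel \<Rightarrow> (nat \<Rightarrow> real) \<Rightarrow> ('v \<Rightarrow> 'v set) measure" where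
  "config_measure d V E p = (\<Pi>\<^sub>M x\<in>V. state_measure d p (E `` {x}))"

definition open_edges :: "'v set \<Rightarrow> ('v \<Rightarrow> 'v set) \<Rightarrow> 'v rel" where
  "open_edges V \<omega> = {(x, y). x \<in> V \<and> y \<in> \<omega> x}"

text \<open>
  Strong connectivity here requires a path each of whose steps is open in both directions, which
  is more than having an open path from \<open>x\<close> to \<open>y\<close> and one from \<open>y\<close> to \<open>x\<close>
  on a general graph.
\<close>

definition strongly_connected_in :: "'v set \<Rightarrow> ('v \<Rightarrow> 'v set) \<Rightarrow> 'v rel" where
  "strongly_connected_in V \<omega> =
     {(x, y). (x, y) \<in> open_edges V \<omega> \<and> (y, x) \<in> open_edges V \<omega>}\<^sup>*"

definition strong_cluster :: "'v set \<Rightarrow> ('v \<Rightarrow> 'v set) \<Rightarrow> 'v \<Rightarrow> 'v set" where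
  "strong_cluster V \<omega> x = {y \<in> V. (x, y) \<in> strongly_connected_in V \<omega>}"

definition strong_percolation_prob ::
    "nat \<Rightarrow> 'v set \<Rightarrow> 'v rel \<Rightarrow> 'v \<Rightarrow> (nat \<Rightarrow> real) \<Rightarrow> real" where
  "strong_percolation_prob d V E orig p =
     measure (config_measure d V E p)
       {\<omega> \<in> space (config_measure d V E p). infinite (strong_cluster V \<omega> orig)}"

end

theory Submission
  imports Defs
begin

text \<open>
  Exploring the strong cluster from the origin gives a Galton--Watson process. Given that the parent
  of \<open>x\<close> lies in the state of \<open>x\<close>, the children of \<open>x\<close> are those further elements of the state
  whose own state points back to \<open>x\<close>, so the mean number of children is \<open>(\<Sum>i. p i * i * (i - 1)) / d\<close>.
  The probability \<open>a n\<close> that an edge continues for \<open>n\<close> more generations satisfies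
  \<open>a (n + 1) = f (a n)\<close> with \<open>f s = (\<Sum>i. p i * (i / d) * (1 - (1 - s) ^ (i - 1)))\<close>, and
  \<open>f' 0\<close> is the mean. If it exceeds \<open>1\<close>, then \<open>a n\<close> stays above some
  \<open>\<epsilon> > 0\<close> with \<open>f \<epsilon> \<ge> \<epsilon>\<close>. If it is at most \<open>1\<close>, then
  \<open>f s < s\<close> on \<open>(0, 1]\<close>, because for \<open>d \<ge> 3\<close> the critical offspring law is not
  deterministic, so \<open>a n\<close> tends to \<open>0\<close>. Hence percolation occurs iff
  \<open>(\<Sum>i. p i * i * (i - 1)) > d\<close>, and both claims are instances of this.
\<close>

section \<open>Simple paths in a relation\<close>

text \<open>A path of least length visits no vertex twice, since cutting out the loop would shorten
  it.\<close>

lemma rtrancl_injective_path: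
  assumes "(a, b) \<in> R\<^sup>*"
  obtains f and m :: nat where "f 0 = a" "f m = b" "\<And>i. i < m \<Longrightarrow> (f i, f (Suc i)) \<in> R" "inj_on f {..m}"
proof -
  define m where "m = (LEAST m. (a, b) \<in> R ^^ m)"
  have "(a, b) \<in> R ^^ m"
    using assms unfolding m_def rtrancl_power by (rule LeastI_ex)
  then obtain f where f: "f 0 = a" "f m = b" "\<And>i. i < m \<Longrightarrow> (f i, f (Suc i)) \<in> R"
    by (auto simp: relpow_fun_conv)
  have "f i \<noteq> f j" if "i < j" "j \<le> m" for i j
  proof
    assume eq: "f i = f j"
    have "(a, f i) \<in> R ^^ i"
      using f that by (auto simp: relpow_fun_conv intro!: exI[of _ f])
    moreover have "(f j, b) \<in> R ^^ (m - j)"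
      using f that by (auto simp: relpow_fun_conv intro!: exI[of _ "\<lambda>k. f (k + j)"])
    ultimately have "(a, b) \<in> R ^^ (i + (m - j))"
      using eq by (auto simp: relpow_add)
    then have "m \<le> i + (m - j)"
      unfolding m_def by (rule Least_le)
    with that show False by simp
  qed
  then have "inj_on f {..m}"
    by (intro linorder_inj_onI) auto
  with f that show thesis by blast
qed

section \<open>Independence in product spaces\<close>

text \<open>Independence means that the joint law is the product of the marginals. Here the joint
  map is the identity on the space, and the marginals are the \<open>M i\<close>.\<close>

lemma indep_vars_PiM_coordinate:
  assumes "\<And>i. i \<in> I \<Longrightarrow> prob_space (M i)" and "I \<noteq> {}"
  shows "prob_space.indep_vars (PiM I M) M (\<lambda>i \<omega>. \<omega> i) I"
proof -
  interpret prob_space "PiM I M"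
    using assms(1) by (rule prob_space_PiM)
  have "distr (PiM I M) (PiM I M) (\<lambda>\<omega>. \<lambda>i\<in>I. \<omega> i) = distr (PiM I M) (PiM I M) (\<lambda>\<omega>. \<omega>)"
    by (intro distr_cong) (auto simp: space_PiM)
  also have "\<dots> = PiM I (\<lambda>i. distr (PiM I M) (M i) (\<lambda>\<omega>. \<omega> i))"
    by (simp add: distr_id cong: PiM_cong) (intro PiM_cong refl distr_PiM_component[symmetric] assms(1))
  finally show ?thesis
    using assms(2) by (subst indep_vars_iff_distr_eq_PiM') auto
qed

text \<open>Restrictions to disjoint blocks of coordinates are independent. By \<open>dep\<close>,
  the event \<open>A j\<close> is determined by the block \<open>K j\<close>, so it is the preimage
  of an event \<open>B j\<close> of the smaller product.\<close>

lemma prob_PiM_disjoint_coordinates: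
  assumes prob: "\<And>i. i \<in> I \<Longrightarrow> prob_space (M i)"
    and L: "finite L" "L \<noteq> {}"
    and K: "disjoint_family_on K L" "\<And>j. j \<in> L \<Longrightarrow> K j \<subseteq> I" "I \<noteq> {}"
    and A: "\<And>j. j \<in> L \<Longrightarrow> A j \<in> sets (PiM I M)"
    and dep: "\<And>j \<omega> \<omega>'. j \<in> L \<Longrightarrow> \<omega> \<in> A j \<Longrightarrow> \<omega>' \<in> space (PiM I M) \<Longrightarrow>
                (\<And>i. i \<in> K j \<Longrightarrow> \<omega> i = \<omega>' i) \<Longrightarrow> \<omega>' \<in> A j"
  shows "measure (PiM I M) (\<Inter>j\<in>L. A j) = (\<Prod>j\<in>L. measure (PiM I M) (A j))"
proof -
  interpret prob_space "PiM I M"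
    using prob by (rule prob_space_PiM)
  obtain \<omega>0 where \<omega>0: "\<omega>0 \<in> space (PiM I M)"
    using not_empty by blast
  \<comment> \<open>Coordinates outside \<open>K j\<close> are filled in from one fixed point; by
    \<open>dep\<close> this does not change membership in \<open>A j\<close>, and \<open>B j\<close>
    becomes a preimage under a measurable map.\<close>
  define ext where "ext j \<xi> = (\<lambda>i\<in>I. if i \<in> K j then \<xi> i else \<omega>0 i)" for j \<xi>
  define B where "B j = ext j -` A j \<inter> space (PiM (K j) M)" for j
  have ext: "ext j \<in> measurable (PiM (K j) M) (PiM I M)" if "j \<in> L" for j
    unfolding ext_def
  proof (rule measurable_restrict)
    fix i assume "i \<in> I"
    then show "(\<lambda>\<xi>. if i \<in> K j then \<xi> i else \<omega>0 i) \<in> measurable (PiM (K j) M) (M i)"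
      using \<omega>0 by (cases "i \<in> K j") (auto simp: space_PiM intro!: measurable_const)
  qed
  then have B: "B j \<in> sets (PiM (K j) M)" if "j \<in> L" for j
    unfolding B_def using A that by (auto intro: measurable_sets)
  have AB: "A j = (\<lambda>\<omega>. restrict (\<lambda>i. \<omega> i) (K j)) -` B j \<inter> space (PiM I M)" if j: "j \<in> L" for j
  proof (intro set_eqI iffI)
    fix \<omega> assume "\<omega> \<in> A j"
    moreover from this have sp: "\<omega> \<in> space (PiM I M)"
      using sets.sets_into_space[OF A[OF j]] by auto
    moreover have r: "restrict \<omega> (K j) \<in> space (PiM (K j) M)"
      using sp K(2)[OF j] by (auto simp: space_PiM)
    moreover have "ext j (restrict \<omega> (K j)) \<in> A j"
      by (rule dep[OF j \<open>\<omega> \<in> A j\<close> measurable_space[OF ext[OF j] r]])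
         (use K(2)[OF j] in \<open>auto simp: ext_def\<close>)
    ultimately show "\<omega> \<in> (\<lambda>\<omega>. restrict (\<lambda>i. \<omega> i) (K j)) -` B j \<inter> space (PiM I M)"
      by (simp add: B_def)
  next
    fix \<omega> assume "\<omega> \<in> (\<lambda>\<omega>. restrict (\<lambda>i. \<omega> i) (K j)) -` B j \<inter> space (PiM I M)"
    then have "ext j (restrict \<omega> (K j)) \<in> A j" "\<omega> \<in> space (PiM I M)"
      by (auto simp: B_def)
    then show "\<omega> \<in> A j"
      by (rule dep[OF j]) (use K(2)[OF j] in \<open>auto simp: ext_def\<close>)
  qed
  have "indep_vars (\<lambda>j. PiM (K j) M) (\<lambda>j \<omega>. restrict (\<lambda>i. \<omega> i) (K j)) L"
    using indep_vars_PiM_coordinate[OF prob K(3)] K(2,1) by (rule indep_vars_restrict)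
  from indep_varsD_finite[OF this L(2,1) B] show ?thesis
    using AB by simp
qed

section \<open>Sums over subsets and Bernoulli bounds\<close>

lemma sum_Pow_card:
  fixes h :: "nat \<Rightarrow> real"
  assumes "finite L"
  shows "(\<Sum>S\<in>Pow L. h (card S)) = (\<Sum>j\<le>card L. real (card L choose j) * h j)"
proof -
  have "(\<Sum>S\<in>Pow L. h (card S)) = (\<Sum>j\<le>card L. \<Sum>S | S \<in> Pow L \<and> card S = j. h (card S))"
    using assms by (intro sum.group[symmetric]) (auto intro: card_mono)
  also have "\<dots> = (\<Sum>j\<le>card L. real (card L choose j) * h j)"
  proof (rule sum.cong)
    fix j
    have "(\<Sum>S | S \<in> Pow L \<and> card S = j. h (card S)) = (\<Sum>S | S \<subseteq> L \<and> card S = j. h j)"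
      by (intro sum.cong) auto
    then show "(\<Sum>S | S \<in> Pow L \<and> card S = j. h (card S)) = real (card L choose j) * h j"
      using n_subsets[OF assms] by simp
  qed simp
  finally show ?thesis .
qed

text \<open>This is size biasing: if all sets of equal size are equally likely, a fixed
  \<open>y\<close> lies in a random set of size \<open>i\<close> with probability
  \<open>i / card L\<close>. Removing \<open>y\<close> from each set reduces the claim to the
  absorption identity for binomial coefficients.\<close>

lemma sum_Pow_card_insert:
  fixes h :: "nat \<Rightarrow> real"
  assumes "finite L" "y \<in> L"
  shows "(\<Sum>S | S \<in> Pow L \<and> y \<in> S. h (card S) / real (card L choose card S)) =
         (\<Sum>i\<le>card L. h i * real i / real (card L))"
proof -
  define c where "c = card L - 1"
  have c: "card L = Suc c" "card (L - {y}) = c"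
    using assms card_gt_0_iff[of L] by (auto simp: c_def)
  define g where "g i = h i / real (card L choose i)" for i
  have "(\<Sum>S | S \<in> Pow L \<and> y \<in> S. g (card S)) = (\<Sum>S\<in>Pow (L - {y}). g (Suc (card S)))"
  proof (rule sum.reindex_bij_witness[of _ "insert y" "\<lambda>S. S - {y}"])
    fix S assume "S \<in> {S. S \<in> Pow L \<and> y \<in> S}"
    then have "Suc (card (S - {y})) = card S"
      using assms(1) by (intro card_Suc_Diff1) (auto dest: finite_subset)
    then show "g (Suc (card (S - {y}))) = g (card S)" by simp
  qed (use assms in auto)
  also have "\<dots> = (\<Sum>j\<le>c. real (c choose j) * g (Suc j))"
    using sum_Pow_card[of "L - {y}" "\<lambda>j. g (Suc j)"] assms c by simp
  also have "\<dots> = (\<Sum>j\<le>c. h (Suc j) * real (Suc j) / real (Suc c))"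
  proof (rule sum.cong)
    fix j assume "j \<in> {..c}"
    then have pos: "(Suc c choose Suc j) > 0" by simp
    have "real (Suc j) * real (Suc c choose Suc j) = real (Suc c) * real (c choose j)"
      by (metis of_nat_mult Suc_times_binomial)
    with pos show "real (c choose j) * g (Suc j) = h (Suc j) * real (Suc j) / real (Suc c)"
      unfolding g_def c by (simp add: field_simps del: binomial_Suc_Suc of_nat_Suc)
  qed simp
  also have "\<dots> = (\<Sum>i\<le>card L. h i * real i / real (card L))"
    unfolding c by (subst sum.atMost_Suc_shift) simp
  finally show ?thesis by (simp add: g_def)
qed

lemma one_minus_power_le_linear:
  fixes s :: real
  assumes "s \<le> 1"
  shows "1 - (1 - s) ^ n \<le> real n * s"
  using Bernoulli_inequality[of "- s" n] assms by simp

text \<open>Splitting off one factor before applying Bernoulli's inequality leaves a surplus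
  \<open>(n - 1) * s * s\<close>, which gives strictness.\<close>

lemma one_minus_power_less_linear:
  fixes s :: real
  assumes "0 < s" "s \<le> 1" "2 \<le> n"
  shows "1 - (1 - s) ^ n < real n * s"
proof -
  obtain j where n: "n = Suc j" "j \<ge> 1"
    using assms(3) by (cases n) auto
  have "(1 - s) * (1 - real j * s) \<le> (1 - s) * (1 - s) ^ j"
    using one_minus_power_le_linear[OF assms(2), of j] assms by (intro mult_left_mono) auto
  moreover have "(1 - s) * (1 - real j * s) = 1 - real n * s + real j * s\<^sup>2"
    using n by (simp add: algebra_simps power2_eq_square)
  moreover have "real j * s\<^sup>2 > 0"
    using n assms by simp
  ultimately show ?thesis using n by simp
qed

section \<open>Branches of the tree and the exploration event\<close>

text \<open>For adjacent \<open>x\<close> and \<open>y\<close> this is the component of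
  \<open>x\<close> after deletion of \<open>y\<close>, that is, \<open>x\<close> with its
  descendants when \<open>y\<close> is regarded as its parent.\<close>

definition branch :: "'v rel \<Rightarrow> 'v \<Rightarrow> 'v \<Rightarrow> 'v set" where
  "branch E y x = {v. (x, v) \<in> (E \<inter> (- {y}) \<times> (- {y}))\<^sup>*}"

text \<open>
  Half of the first edge is left out of the event (\<open>x \<in> \<omega> y\<close> is not required), so that
  \<open>reach n y x\<close> depends only on the states in the branch of \<open>x\<close> away from \<open>y\<close>.
\<close>

primrec reach :: "nat \<Rightarrow> 'v \<Rightarrow> 'v \<Rightarrow> ('v \<Rightarrow> 'v set) \<Rightarrow> bool" where
  "reach 0 y x \<omega> \<longleftrightarrow> y \<in> \<omega> x"
| "reach (Suc n) y x \<omega> \<longleftrightarrow> y \<in> \<omega> x \<and> (\<exists>z\<in>\<omega> x - {y}. reach n x z \<omega>)"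

lemma reach_Suc_imp: "reach (Suc n) y x \<omega> \<Longrightarrow> reach n y x \<omega>"
  by (induction n arbitrary: y x) auto

locale percolation_tree =
  fixes d :: nat and V :: "'v set" and E :: "'v rel" and p :: "nat \<Rightarrow> real"
  assumes d: "d \<ge> 3" and tree: "regular_tree d V E" and pv: "prob_vector d p"
begin

section \<open>Tree geometry\<close>

lemma edge_in_V: "(x, y) \<in> E \<Longrightarrow> x \<in> V" "(x, y) \<in> E \<Longrightarrow> y \<in> V"
  using tree by (auto simp: regular_tree_def)

lemma edge_sym: "(x, y) \<in> E \<Longrightarrow> (y, x) \<in> E"
  using tree by (auto simp: regular_tree_def dest: symD)

lemma edge_neq: "(x, y) \<in> E \<Longrightarrow> x \<noteq> y"
  using tree by (auto simp: regular_tree_def has_cycle_def)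

lemma finite_nbrs: "x \<in> V \<Longrightarrow> finite (E `` {x})"
  using tree by (auto simp: regular_tree_def)

lemma card_nbrs: "x \<in> V \<Longrightarrow> card (E `` {x}) = d"
  using tree by (auto simp: regular_tree_def)

text \<open>A simple path between distinct neighbours of \<open>x\<close> that avoids
  \<open>x\<close> would close up through \<open>x\<close> to a cycle. This is where the absence of
  cycles on three or more vertices enters.\<close>

lemma nbrs_connected_avoiding_eq:
  assumes "(x, z) \<in> E" "(x, z') \<in> E" "(z, z') \<in> (E \<inter> (- {x}) \<times> (- {x}))\<^sup>*"
  shows "z = z'"
proof (rule ccontr)
  assume "z \<noteq> z'"
  from assms(3) obtain f m where f: "f 0 = z" "f m = z'"
      "\<And>i. i < m \<Longrightarrow> (f i, f (Suc i)) \<in> E \<inter> (- {x}) \<times> (- {x})" "inj_on f {..m}"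
    by (rule rtrancl_injective_path) blast
  have m: "m > 0" using f \<open>z \<noteq> z'\<close> by (cases m) auto
  \<comment> \<open>The closed path has \<open>m + 2\<close> vertices, and \<open>m > 0\<close>
    makes this at least three, as \<open>has_cycle\<close> demands.\<close>
  define zs where "zs = x # map f [0..<Suc m]"
  have fx: "f i \<noteq> x" if "i \<le> m" for i
    using f(2) f(3)[of i] that assms(2) edge_neq by (cases "i = m") auto
  have "distinct zs"
  proof -
    have "x \<notin> f ` {..m}" using fx by auto
    then show ?thesis
      using f(4)
      by (simp add: zs_def distinct_map atLeast0LessThan lessThan_Suc_atMost del: upt_Suc)
  qed
  moreover have len: "length zs = Suc (Suc m)"
    by (simp add: zs_def)
  moreover have "(zs ! i, zs ! (Suc i mod length zs)) \<in> E" if "i < length zs" for i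
  proof -
    have nth: "zs ! Suc j = f j" if "j \<le> m" for j
      using that by (auto simp: zs_def less_Suc_eq_le simp del: upt_Suc)
    have nth0: "zs ! 0 = x" by (simp add: zs_def)
    consider "i = 0" | j where "i = Suc j" "j < m" | "i = Suc m"
      using \<open>i < length zs\<close> len by (cases i) (auto simp: less_Suc_eq)
    then show ?thesis
    proof cases
      case 1
      then show ?thesis using nth[of 0] nth0 len f(1) assms(1) by simp
    next
      case 2
      then show ?thesis using nth[of j] nth[of "Suc j"] len f(3)[of j] by simp
    next
      case 3
      then show ?thesis using nth[of m] nth0 len f(2) edge_sym[OF assms(2)] by simp
    qed
  qed
  ultimately have "has_cycle E"
    using m unfolding has_cycle_def by (intro disjI2 exI[of _ zs]) auto
  then show False using tree by (auto simp: regular_tree_def)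
qed

lemma branch_self: "x \<in> branch E y x"
  by (simp add: branch_def)

lemma root_notin_branch: "(y, x) \<in> E \<Longrightarrow> y \<notin> branch E y x"
  by (auto simp: branch_def dest: edge_neq elim: rtranclE)

lemma sym_avoiding: "sym (E \<inter> (- {y}) \<times> (- {y}))"
  using edge_sym by (auto intro: symI)

lemma branch_disjoint:
  assumes "(x, z) \<in> E" "(x, z') \<in> E" "z \<noteq> z'"
  shows "branch E x z \<inter> branch E x z' = {}"
proof (rule ccontr)
  assume "branch E x z \<inter> branch E x z' \<noteq> {}"
  then have "(z, z') \<in> (E \<inter> (- {x}) \<times> (- {x}))\<^sup>*"
    unfolding branch_def by (auto intro: rtrancl_trans symD[OF sym_rtrancl[OF sym_avoiding]])
  with assms nbrs_connected_avoiding_eq show False by blast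
qed

text \<open>A path from \<open>z\<close> that avoids \<open>x\<close> cannot meet \<open>y\<close>,
  because \<open>y\<close> and \<open>z\<close> are distinct neighbours of \<open>x\<close>.
  Preceded by the edge from \<open>x\<close> to \<open>z\<close>, it is a path from \<open>x\<close>
  that avoids \<open>y\<close>.\<close>

lemma branch_subset:
  assumes "(y, x) \<in> E" "(x, z) \<in> E" "z \<noteq> y"
  shows "branch E x z \<subseteq> branch E y x"
proof
  fix v assume "v \<in> branch E x z"
  then have "(z, v) \<in> (E \<inter> (- {x}) \<times> (- {x}))\<^sup>*" by (simp add: branch_def)
  then have "v \<noteq> y \<and> (x, v) \<in> (E \<inter> (- {y}) \<times> (- {y}))\<^sup>*"
  proof (induction rule: rtrancl_induct)
    case base
    then show ?case using assms edge_neq by auto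
  next
    case (step v w)
    have "(z, w) \<in> (E \<inter> (- {x}) \<times> (- {x}))\<^sup>*"
      using step.hyps by (rule rtrancl_into_rtrancl)
    then have "w \<noteq> y"
      using nbrs_connected_avoiding_eq[OF assms(2) edge_sym[OF assms(1)]] assms(3) by blast
    with step show ?case by (auto intro: rtrancl_into_rtrancl)
  qed
  then show "v \<in> branch E y x" by (simp add: branch_def)
qed

lemma branch_subset_V:
  assumes "x \<in> V"
  shows "branch E y x \<subseteq> V"
proof
  fix v assume "v \<in> branch E y x"
  then have "(x, v) \<in> (E \<inter> (- {y}) \<times> (- {y}))\<^sup>*" by (simp add: branch_def)
  then show "v \<in> V"
    using \<open>x \<in> V\<close> by (cases rule: rtranclE) (auto dest: edge_in_V)
qed

section \<open>The configuration space and the law of a single state\<close>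

abbreviation P where "P \<equiv> config_measure d V E p"

lemma space_P: "space P = (\<Pi>\<^sub>E x\<in>V. Pow (E `` {x}))"
  by (simp add: config_measure_def space_PiM state_measure_def space_point_measure)

lemma config_subset: "\<omega> \<in> space P \<Longrightarrow> x \<in> V \<Longrightarrow> \<omega> x \<subseteq> E `` {x}"
  by (auto simp: space_P PiE_def Pi_def)

lemma prob_space_state:
  assumes "x \<in> V"
  shows "prob_space (state_measure d p (E `` {x}))"
proof -
  have "(\<Sum>S\<in>Pow (E `` {x}). p (card S) / real (d choose card S)) =
        (\<Sum>j\<le>d. real (d choose j) * (p j / real (d choose j)))"
    using sum_Pow_card[OF finite_nbrs[OF assms], of "\<lambda>i. p i / real (d choose i)"]
    by (simp add: card_nbrs[OF assms])
  also have "\<dots> = (\<Sum>j\<le>d. p j)"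
    by (intro sum.cong) auto
  also have "\<dots> = 1" using pv by (simp add: prob_vector_def)
  finally have *: "(\<Sum>S\<in>Pow (E `` {x}). p (card S) / real (d choose card S)) = 1" .
  have nonneg: "p (card S) / real (d choose card S) \<ge> 0" if "S \<in> Pow (E `` {x})" for S
    using that pv card_mono[OF finite_nbrs[OF assms], of S] card_nbrs[OF assms]
    by (auto simp: prob_vector_def)
  have "(\<Sum>S\<in>Pow (E `` {x}). ennreal (p (card S) / real (d choose card S))) = 1"
    by (subst sum_ennreal[OF nonneg]) (simp_all only: * ennreal_1)
  then show ?thesis
    unfolding state_measure_def using finite_nbrs[OF assms]
    by (intro prob_space_point_measure) auto
qed

sublocale prob_space P
  unfolding config_measure_def by (intro prob_space_PiM prob_space_state)

text \<open>The sigma-field on the states of one vertex is discrete, so every predicate of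
  \<open>\<omega> x\<close> is admissible.\<close>

lemma measurable_coordinate:
  assumes "x \<in> V"
  shows "{\<omega> \<in> space P. Q (\<omega> x)} \<in> sets P"
proof -
  let ?M = "state_measure d p (E `` {x})"
  have "(\<lambda>\<omega>. \<omega> x) \<in> measurable P ?M"
    unfolding config_measure_def using assms by (rule measurable_component_singleton)
  moreover have "{S \<in> space ?M. Q S} \<in> sets ?M"
    by (auto simp: state_measure_def space_point_measure sets_point_measure)
  ultimately have "(\<lambda>\<omega>. \<omega> x) -` {S \<in> space ?M. Q S} \<inter> space P \<in> sets P"
    by (rule measurable_sets)
  moreover have "(\<lambda>\<omega>. \<omega> x) -` {S \<in> space ?M. Q S} \<inter> space P = {\<omega> \<in> space P. Q (\<omega> x)}"
    using config_subset assms by (auto simp: state_measure_def space_point_measure)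
  ultimately show ?thesis by simp
qed

lemma measurable_state: "x \<in> V \<Longrightarrow> {\<omega> \<in> space P. \<omega> x = S} \<in> sets P"
  using measurable_coordinate[of x "\<lambda>T. T = S"] by simp

definition weight :: "'v set \<Rightarrow> real" where
  "weight S = p (card S) / real (d choose card S)"

lemma prob_state:
  assumes "x \<in> V" "S \<subseteq> E `` {x}"
  shows "prob {\<omega> \<in> space P. \<omega> x = S} = weight S"
proof -
  let ?M = "state_measure d p (E `` {x})"
  have "measure ?M {S} = measure (distr P ?M (\<lambda>\<omega>. \<omega> x)) {S}"
    unfolding config_measure_def
    using distr_PiM_component[where I = V and M = "\<lambda>x. state_measure d p (E `` {x})", OF prob_space_state assms(1)]
    by simp
  also have "\<dots> = prob ((\<lambda>\<omega>. \<omega> x) -` {S} \<inter> space P)"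
    unfolding config_measure_def using assms
    by (intro measure_distr measurable_component_singleton)
       (auto simp: state_measure_def sets_point_measure)
  also have "(\<lambda>\<omega>. \<omega> x) -` {S} \<inter> space P = {\<omega> \<in> space P. \<omega> x = S}" by auto
  finally have "prob {\<omega> \<in> space P. \<omega> x = S} = measure ?M {S}" by simp
  also have "\<dots> = weight S"
  proof -
    have "p (card S) \<ge> 0"
      using assms pv card_mono[OF finite_nbrs[OF assms(1)], of S] card_nbrs[OF assms(1)]
      by (auto simp: prob_vector_def)
    then show ?thesis
      using assms finite_nbrs[OF assms(1)]
      by (simp add: state_measure_def weight_def measure_def emeasure_point_measure_finite)
  qed
  finally show ?thesis .
qed

section \<open>The recursion for the probability of \<open>reach\<close>\<close>

lemma measurable_reach:
  assumes "x \<in> V"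
  shows "{\<omega> \<in> space P. reach n y x \<omega>} \<in> sets P"
  using assms
proof (induction n arbitrary: y x)
  case 0
  then show ?case by (simp add: measurable_coordinate)
next
  case (Suc n)
  have "{\<omega> \<in> space P. reach (Suc n) y x \<omega>} =
        (\<Union>z\<in>E `` {x} - {y}. {\<omega> \<in> space P. y \<in> \<omega> x \<and> z \<in> \<omega> x} \<inter> {\<omega> \<in> space P. reach n x z \<omega>})"
    using config_subset[OF _ Suc.prems] by auto
  also have "\<dots> \<in> sets P"
    using Suc finite_nbrs by (intro sets.finite_UN sets.Int measurable_coordinate) (auto dest: edge_in_V)
  finally show ?case .
qed

text \<open>Each recursive call concerns a child whose branch lies inside the present one. That
  \<open>\<omega>\<close> is a configuration ensures that the members of \<open>\<omega> x\<close>
  are neighbours of \<open>x\<close>.\<close>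

lemma reach_depends_on_branch:
  assumes "\<omega> \<in> space P" "(y, x) \<in> E" "\<And>v. v \<in> branch E y x \<Longrightarrow> \<omega> v = \<omega>' v"
  shows "reach n y x \<omega> \<longleftrightarrow> reach n y x \<omega>'"
  using assms(2,3)
proof (induction n arbitrary: y x)
  case 0
  then show ?case using branch_self[of x y] by simp
next
  case (Suc n)
  have "reach n x z \<omega> \<longleftrightarrow> reach n x z \<omega>'" if "z \<in> \<omega> x - {y}" for z
  proof -
    have z: "(x, z) \<in> E" "z \<noteq> y"
      using that config_subset[OF assms(1), of x] edge_in_V Suc.prems(1) by auto
    show ?thesis
      using Suc.IH[OF z(1)] Suc.prems(2) branch_subset[OF Suc.prems(1) z] by blast
  qed
  moreover have "\<omega> x = \<omega>' x" using Suc.prems(2) branch_self by blast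
  ultimately show ?case by auto
qed

text \<open>The state of \<open>x\<close> and the events \<open>reach n x z\<close> depend on the
  disjoint sets \<open>{x}\<close> and \<open>branch E x z\<close>, hence are independent. The
  failure of all \<open>z\<close> therefore factors, and the claim follows by taking the complement
  within the event \<open>\<omega> x = S\<close>.\<close>

lemma prob_state_reach:
  assumes x: "x \<in> V" and S: "S \<subseteq> E `` {x}" and N: "N \<subseteq> S"
    and a: "\<And>z. z \<in> N \<Longrightarrow> prob {\<omega> \<in> space P. reach n x z \<omega>} = a"
  shows "prob {\<omega> \<in> space P. \<omega> x = S \<and> (\<exists>z\<in>N. reach n x z \<omega>)} = weight S * (1 - (1 - a) ^ card N)"
proof -
  \<comment> \<open>The index \<open>x\<close> carries the event on the state of \<open>x\<close>,
    and the indices in \<open>N\<close> carry the failures. As \<open>x\<close> is not in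
    \<open>N\<close>, one product over \<open>insert x N\<close> covers both.\<close>
  define A where "A v = (if v = x then {\<omega> \<in> space P. \<omega> x = S} else {\<omega> \<in> space P. \<not> reach n x v \<omega>})" for v
  define K where "K v = (if v = x then {x} else branch E x v)" for v
  have edge: "(x, z) \<in> E" if "z \<in> N" for z using that S N by auto
  have xN: "x \<notin> N" using edge edge_neq by auto
  have finN: "finite N" using finite_subset[OF subset_trans[OF N S] finite_nbrs[OF x]] .
  have Nx: "\<And>z. z \<in> N \<Longrightarrow> z \<noteq> x" using xN by auto
  have Ameas: "A v \<in> sets P" if "v \<in> insert x N" for v
  proof (cases "v = x")
    case False
    then have "v \<in> V" using that edge_in_V(2)[OF edge] by auto
    then have "space P - {\<omega> \<in> space P. reach n x v \<omega>} \<in> sets P"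
      by (intro sets.compl_sets measurable_reach)
    moreover have "space P - {\<omega> \<in> space P. reach n x v \<omega>} = {\<omega> \<in> space P. \<not> reach n x v \<omega>}" by auto
    ultimately show ?thesis using False by (simp add: A_def)
  qed (use x in \<open>simp add: A_def measurable_state\<close>)
  have "prob (\<Inter>v\<in>insert x N. A v) = (\<Prod>v\<in>insert x N. prob (A v))"
    unfolding config_measure_def
  proof (rule prob_PiM_disjoint_coordinates[where K = K])
    show "disjoint_family_on K (insert x N)"
      unfolding disjoint_family_on_def
    proof (intro ballI impI)
      fix u v assume "u \<in> insert x N" "v \<in> insert x N" "u \<noteq> v"
      then show "K u \<inter> K v = {}"
        using root_notin_branch[of x u] root_notin_branch[of x v] branch_disjoint[of x u v]
          edge[of u] edge[of v]
        by (cases "u = x"; cases "v = x") (auto simp: K_def)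
    qed
    show "K j \<subseteq> V" if "j \<in> insert x N" for j
      using that x edge_in_V(2)[OF edge[of j]] branch_subset_V[of j x] by (auto simp: K_def)
    show "V \<noteq> {}" using x by auto
    show "A j \<in> sets (\<Pi>\<^sub>M x\<in>V. state_measure d p (E `` {x}))" if "j \<in> insert x N" for j
      using Ameas[OF that] by (simp add: config_measure_def)
    show "\<omega>' \<in> A j" if j: "j \<in> insert x N" and \<omega>: "\<omega> \<in> A j"
        and "\<omega>' \<in> space (\<Pi>\<^sub>M x\<in>V. state_measure d p (E `` {x}))"
        and eq: "\<And>i. i \<in> K j \<Longrightarrow> \<omega> i = \<omega>' i" for j \<omega> \<omega>'
    proof -
      have \<omega>': "\<omega>' \<in> space P" using that(3) by (simp add: config_measure_def)
      show ?thesis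
      proof (cases "j = x")
        case True
        then show ?thesis using \<omega> \<omega>' eq by (auto simp: A_def K_def)
      next
        case False
        then have "(x, j) \<in> E" using j edge by auto
        then show ?thesis
          using False \<omega> \<omega>' eq reach_depends_on_branch[of \<omega> x j \<omega>' n] by (auto simp: A_def K_def)
      qed
    qed
  qed (use finN prob_space_state in auto)
  also have "(\<Inter>v\<in>insert x N. A v) = {\<omega> \<in> space P. \<omega> x = S \<and> (\<forall>z\<in>N. \<not> reach n x z \<omega>)}"
    using Nx by (auto simp: A_def)
  also have "(\<Prod>v\<in>insert x N. prob (A v)) = prob (A x) * (\<Prod>v\<in>N. prob (A v))"
    using finN xN by simp
  also have "prob (A x) = weight S"
    using prob_state[OF x S] by (simp add: A_def)
  also have "(\<Prod>v\<in>N. prob (A v)) = (\<Prod>v\<in>N. 1 - a)"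
  proof (rule prod.cong)
    fix v assume v: "v \<in> N"
    then have "v \<in> V" by (rule edge_in_V(2)[OF edge])
    then show "prob (A v) = 1 - a"
      using prob_neg[OF measurable_reach[of v n x]] a[OF v] Nx[OF v] by (simp add: A_def)
  qed simp
  finally have none: "prob {\<omega> \<in> space P. \<omega> x = S \<and> (\<forall>z\<in>N. \<not> reach n x z \<omega>)} = weight S * (1 - a) ^ card N"
    by simp
  have Uset: "{\<omega> \<in> space P. \<omega> x = S \<and> (\<forall>z\<in>N. \<not> reach n x z \<omega>)} = (\<Inter>v\<in>insert x N. A v)"
    using Nx by (auto simp: A_def)
  have "{\<omega> \<in> space P. \<omega> x = S \<and> (\<forall>z\<in>N. \<not> reach n x z \<omega>)} \<in> sets P"
    unfolding Uset using Ameas finN by (intro sets.finite_INT) auto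
  then have "prob ({\<omega> \<in> space P. \<omega> x = S} - {\<omega> \<in> space P. \<omega> x = S \<and> (\<forall>z\<in>N. \<not> reach n x z \<omega>)}) =
     weight S - weight S * (1 - a) ^ card N"
    using none prob_state[OF x S] measurable_state[OF x]
    by (subst finite_measure_Diff) auto
  also have "{\<omega> \<in> space P. \<omega> x = S} - {\<omega> \<in> space P. \<omega> x = S \<and> (\<forall>z\<in>N. \<not> reach n x z \<omega>)} =
     {\<omega> \<in> space P. \<omega> x = S \<and> (\<exists>z\<in>N. reach n x z \<omega>)}" by auto
  finally show ?thesis by (simp add: algebra_simps)
qed

lemma measurable_state_reach:
  assumes x: "x \<in> V" and S: "S \<subseteq> E `` {x}" and N: "N \<subseteq> S"
  shows "{\<omega> \<in> space P. \<omega> x = S \<and> (\<exists>z\<in>N. reach n x z \<omega>)} \<in> sets P"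
proof -
  have "{\<omega> \<in> space P. \<omega> x = S \<and> (\<exists>z\<in>N. reach n x z \<omega>)} =
      {\<omega> \<in> space P. \<omega> x = S} \<inter> (\<Union>z\<in>N. {\<omega> \<in> space P. reach n x z \<omega>})" by auto
  also have "\<dots> \<in> sets P"
    using S N finite_subset[OF subset_trans[OF N S] finite_nbrs[OF x]] x
    by (intro sets.Int sets.finite_UN measurable_reach measurable_state) (auto dest: edge_in_V)
  finally show ?thesis .
qed

lemma prob_exists_reach:
  assumes x: "x \<in> V" and a: "\<And>z. (x, z) \<in> E \<Longrightarrow> prob {\<omega> \<in> space P. reach n x z \<omega>} = a"
    and N: "\<And>S. N S \<subseteq> S"
  shows "prob {\<omega> \<in> space P. Q (\<omega> x) \<and> (\<exists>z\<in>N (\<omega> x). reach n x z \<omega>)} =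
    (\<Sum>S | S \<in> Pow (E `` {x}) \<and> Q S. weight S * (1 - (1 - a) ^ card (N S)))"
proof -
  let ?I = "{S. S \<in> Pow (E `` {x}) \<and> Q S}"
  let ?B = "\<lambda>S. {\<omega> \<in> space P. \<omega> x = S \<and> (\<exists>z\<in>N S. reach n x z \<omega>)}"
  have "{\<omega> \<in> space P. Q (\<omega> x) \<and> (\<exists>z\<in>N (\<omega> x). reach n x z \<omega>)} = (\<Union>S\<in>?I. ?B S)"
    using config_subset[OF _ x] by auto
  then have "prob {\<omega> \<in> space P. Q (\<omega> x) \<and> (\<exists>z\<in>N (\<omega> x). reach n x z \<omega>)} = prob (\<Union>S\<in>?I. ?B S)"
    by (rule arg_cong)
  also have "\<dots> = (\<Sum>S\<in>?I. prob (?B S))"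
  proof (rule finite_measure_finite_Union)
    show "finite ?I" using finite_nbrs[OF x] by simp
    show "?B ` ?I \<subseteq> sets P"
      by (intro image_subsetI measurable_state_reach[OF x _ N]) simp
    show "disjoint_family_on ?B ?I"
      unfolding disjoint_family_on_def by blast
  qed
  also have "\<dots> = (\<Sum>S\<in>?I. weight S * (1 - (1 - a) ^ card (N S)))"
  proof (rule sum.cong)
    fix S assume "S \<in> ?I"
    then have S: "S \<subseteq> E `` {x}" by simp
    have "prob {\<omega> \<in> space P. reach n x z \<omega>} = a" if "z \<in> N S" for z
      using a[of z] that N[of S] S by blast
    then show "prob (?B S) = weight S * (1 - (1 - a) ^ card (N S))"
      by (rule prob_state_reach[OF x S N])
  qed simp
  finally show ?thesis .
qed

text \<open>The probability that the state of a vertex contains a given neighbour; it starts the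
  recursion.\<close>

definition edge_prob :: real where
  "edge_prob = (\<Sum>i\<le>d. p i * real i / real d)"

text \<open>The map \<open>f\<close> of the introduction. At \<open>i = 0\<close> the truncated
  \<open>i - 1\<close> is harmless because of the factor \<open>real i\<close>.\<close>

definition extend_prob :: "real \<Rightarrow> real" where
  "extend_prob s = (\<Sum>i\<le>d. p i * (1 - (1 - s) ^ (i - 1)) * real i / real d)"

text \<open>A state of size \<open>i\<close> contains \<open>y\<close> with probability
  \<open>i / d\<close>, and then leaves \<open>i - 1\<close> independent candidates, each succeeding
  with the probability of the previous stage.\<close>

lemma prob_reach:
  assumes "(y, x) \<in> E"
  shows "prob {\<omega> \<in> space P. reach n y x \<omega>} = (extend_prob ^^ n) edge_prob"
  using assms
proof (induction n arbitrary: y x)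
  case 0
  have x: "x \<in> V" and y: "y \<in> E `` {x}" using 0 edge_in_V edge_sym by auto
  have "{\<omega> \<in> space P. reach 0 y x \<omega>} = (\<Union>S\<in>{S. S \<in> Pow (E `` {x}) \<and> y \<in> S}. {\<omega> \<in> space P. \<omega> x = S})"
    using config_subset[OF _ x] by auto
  also have "prob \<dots> = (\<Sum>S | S \<in> Pow (E `` {x}) \<and> y \<in> S. prob {\<omega> \<in> space P. \<omega> x = S})"
    using finite_nbrs[OF x] x
    by (intro finite_measure_finite_Union) (auto simp: disjoint_family_on_def measurable_state)
  also have "\<dots> = (\<Sum>S | S \<in> Pow (E `` {x}) \<and> y \<in> S. p (card S) / real (card (E `` {x}) choose card S))"
    using prob_state[OF x] by (intro sum.cong) (auto simp: weight_def card_nbrs[OF x])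
  also have "\<dots> = edge_prob"
    using sum_Pow_card_insert[OF finite_nbrs[OF x] y, of p] by (simp only: edge_prob_def card_nbrs[OF x])
  finally show ?case by simp
next
  case (Suc n)
  have x: "x \<in> V" and y: "y \<in> E `` {x}" using Suc edge_in_V edge_sym by auto
  let ?a = "(extend_prob ^^ n) edge_prob"
  have "prob {\<omega> \<in> space P. reach (Suc n) y x \<omega>} =
     (\<Sum>S | S \<in> Pow (E `` {x}) \<and> y \<in> S. weight S * (1 - (1 - ?a) ^ card (S - {y})))"
    using prob_exists_reach[OF x Suc.IH, where Q = "\<lambda>S. y \<in> S" and N = "\<lambda>S. S - {y}"] by auto
  also have "\<dots> = (\<Sum>S | S \<in> Pow (E `` {x}) \<and> y \<in> S.
      (\<lambda>i. p i * (1 - (1 - ?a) ^ (i - 1))) (card S) / real (card (E `` {x}) choose card S))"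
    by (intro sum.cong refl) (simp add: weight_def card_Diff_singleton card_nbrs[OF x])
  also have "\<dots> = extend_prob ?a"
    using sum_Pow_card_insert[OF finite_nbrs[OF x] y, of "\<lambda>i. p i * (1 - (1 - ?a) ^ (i - 1))"]
    by (simp only: extend_prob_def card_nbrs[OF x])
  finally show ?case by simp
qed

text \<open>The origin has no parent: its state size has the law \<open>p\<close> without size
  biasing, and all \<open>i\<close> members are candidates.\<close>

lemma prob_root_reach:
  assumes x: "x \<in> V"
  shows "prob {\<omega> \<in> space P. \<exists>z\<in>\<omega> x. reach n x z \<omega>} = (\<Sum>i\<le>d. p i * (1 - (1 - (extend_prob ^^ n) edge_prob) ^ i))"
proof -
  let ?a = "(extend_prob ^^ n) edge_prob"
  let ?h = "\<lambda>i. p i / real (d choose i) * (1 - (1 - ?a) ^ i)"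
  have "prob {\<omega> \<in> space P. \<exists>z\<in>\<omega> x. reach n x z \<omega>} = (\<Sum>S\<in>Pow (E `` {x}). ?h (card S))"
    using prob_exists_reach[OF x prob_reach, where Q = "\<lambda>S. True" and N = "\<lambda>S. S"]
    by (simp add: weight_def Pow_def)
  also have "\<dots> = (\<Sum>i\<le>d. real (d choose i) * ?h i)"
    using sum_Pow_card[OF finite_nbrs[OF x], of ?h] by (simp only: card_nbrs[OF x])
  also have "\<dots> = (\<Sum>i\<le>d. p i * (1 - (1 - ?a) ^ i))"
    by (intro sum.cong) auto
  finally show ?thesis .
qed

lemma p_nonneg: "i \<le> d \<Longrightarrow> 0 \<le> p i" and sum_p: "(\<Sum>i\<le>d. p i) = 1"
  using pv by (auto simp: prob_vector_def)

section \<open>Infinite strong clusters in terms of \<open>reach\<close>\<close>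

abbreviation mutual :: "('v \<Rightarrow> 'v set) \<Rightarrow> 'v rel" where
  "mutual \<omega> \<equiv> {(x, y). (x, y) \<in> open_edges V \<omega> \<and> (y, x) \<in> open_edges V \<omega>}"

lemma reach_imp_open: "reach n y x \<omega> \<Longrightarrow> y \<in> \<omega> x"
  by (cases n) auto

text \<open>Keeping \<open>F\<close> inside the branch makes the induction work: the set found for
  the child \<open>z\<close> avoids \<open>x\<close>, so inserting \<open>x\<close> raises the
  cardinality by one.\<close>

lemma reach_imp_many_connected:
  assumes "\<omega> \<in> space P" "(y, x) \<in> E" "reach n y x \<omega>"
  shows "\<exists>F. finite F \<and> card F = Suc n \<and> F \<subseteq> branch E y x \<and> F \<subseteq> (mutual \<omega>)\<^sup>* `` {x}"
  using assms(2,3)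
proof (induction n arbitrary: y x)
  case 0
  then show ?case by (intro exI[of _ "{x}"]) (auto simp: branch_self)
next
  case (Suc n)
  then obtain z where z: "z \<in> \<omega> x" "z \<noteq> y" "reach n x z \<omega>" by auto
  have x: "x \<in> V" using Suc.prems edge_in_V by auto
  then have xz: "(x, z) \<in> E" using config_subset[OF assms(1)] z by auto
  obtain F where F: "finite F" "card F = Suc n" "F \<subseteq> branch E x z" "F \<subseteq> (mutual \<omega>)\<^sup>* `` {z}"
    using Suc.IH[OF xz z(3)] by blast
  have "(x, z) \<in> mutual \<omega>"
    using x edge_in_V(2)[OF xz] z reach_imp_open by (auto simp: open_edges_def)
  then have "F \<subseteq> (mutual \<omega>)\<^sup>* `` {x}"
    using F(4) by (auto intro: converse_rtrancl_into_rtrancl)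
  moreover have "x \<notin> F"
    using F(3) root_notin_branch[OF xz] by auto
  ultimately show ?case
    using F branch_subset[OF Suc.prems(1) xz z(2)] branch_self[of x y]
    by (intro exI[of _ "insert x F"]) auto
qed

lemma finite_mutual_ball:
  assumes "\<omega> \<in> space P"
  shows "finite ((mutual \<omega> ^^ n) `` {x})"
proof (induction n)
  case (Suc n)
  have "finite (mutual \<omega> `` {u})" for u
  proof (cases "u \<in> V")
    case True
    then have "mutual \<omega> `` {u} \<subseteq> E `` {u}"
      using config_subset[OF assms] by (auto simp: open_edges_def)
    then show ?thesis using finite_nbrs[OF True] finite_subset by blast
  next
    case False
    then have "mutual \<omega> `` {u} = {}" by (auto simp: open_edges_def)
    then show ?thesis by (simp only: finite.emptyI)
  qed
  moreover have "(mutual \<omega> ^^ Suc n) `` {x} = (\<Union>u\<in>(mutual \<omega> ^^ n) `` {x}. mutual \<omega> `` {u})"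
    by auto
  ultimately show ?case using Suc by simp
qed simp

text \<open>By local finiteness an infinite cluster has vertices at every distance, and a simple
  path to one of them witnesses \<open>reach\<close>. Conversely, \<open>reach n\<close> with
  \<open>n\<close> the size of a finite cluster would give \<open>n + 1\<close> vertices in
  it.\<close>

lemma infinite_strong_cluster_iff:
  assumes \<omega>: "\<omega> \<in> space P" and x: "x \<in> V"
  shows "infinite (strong_cluster V \<omega> x) \<longleftrightarrow> (\<forall>n. \<exists>z\<in>\<omega> x. reach n x z \<omega>)"
proof
  assume inf: "infinite (strong_cluster V \<omega> x)"
  show "\<forall>n. \<exists>z\<in>\<omega> x. reach n x z \<omega>"
  proof
    fix n
    have "finite (\<Union>j\<le>n. (mutual \<omega> ^^ j) `` {x})"
      using finite_mutual_ball[OF \<omega>] by blast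
    then have "\<not> strong_cluster V \<omega> x \<subseteq> (\<Union>j\<le>n. (mutual \<omega> ^^ j) `` {x})"
      using inf finite_subset by blast
    then obtain w where w: "(x, w) \<in> (mutual \<omega>)\<^sup>*" "\<And>j. j \<le> n \<Longrightarrow> (x, w) \<notin> mutual \<omega> ^^ j"
      by (auto simp: strong_cluster_def strongly_connected_in_def)
    from w(1) obtain f m where f: "f 0 = x" "f m = w"
        "\<And>i. i < m \<Longrightarrow> (f i, f (Suc i)) \<in> mutual \<omega>" "inj_on f {..m}"
      by (rule rtrancl_injective_path) blast
    have "(x, w) \<in> mutual \<omega> ^^ m"
      unfolding relpow_fun_conv using f by (intro exI[of _ f]) auto
    with w(2)[of m] have "n < m" by force
    \<comment> \<open>This uses the steps of the path from \<open>f i\<close> to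
      \<open>f (i + k + 1)\<close>, hence \<open>i + k < m\<close>. Injectivity of \<open>f\<close>
      supplies the condition in \<open>reach\<close> that excludes stepping back to the
      parent.\<close>
    have "reach k (f i) (f (Suc i)) \<omega>" if "i + k < m" for i k
      using that
    proof (induction k arbitrary: i)
      case 0
      then show ?case using f(3)[of i] by (auto simp: open_edges_def)
    next
      case (Suc k)
      have "f (Suc (Suc i)) \<noteq> f i"
        using f(4) Suc.prems by (auto dest: inj_onD)
      then show ?case
        using f(3)[of i] f(3)[of "Suc i"] Suc.IH[of "Suc i"] Suc.prems by (auto simp: open_edges_def)
    qed
    from this[of 0 n] \<open>n < m\<close> have "reach n x (f 1) \<omega>" using f(1) by simp
    moreover have "f 1 \<in> \<omega> x"
      using f(1) f(3)[of 0] \<open>n < m\<close> by (auto simp: open_edges_def)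
    ultimately show "\<exists>z\<in>\<omega> x. reach n x z \<omega>" by blast
  qed
next
  assume *: "\<forall>n. \<exists>z\<in>\<omega> x. reach n x z \<omega>"
  show "infinite (strong_cluster V \<omega> x)"
  proof
    assume fin: "finite (strong_cluster V \<omega> x)"
    obtain z where z: "z \<in> \<omega> x" "reach (card (strong_cluster V \<omega> x)) x z \<omega>"
      using * by blast
    have xz: "(x, z) \<in> E" using z config_subset[OF \<omega> x] by auto
    obtain F where F: "card F = Suc (card (strong_cluster V \<omega> x))"
        "F \<subseteq> branch E x z" "F \<subseteq> (mutual \<omega>)\<^sup>* `` {z}"
      using reach_imp_many_connected[OF \<omega> xz z(2)] by blast
    have "(x, z) \<in> mutual \<omega>"
      using x z edge_in_V(2)[OF xz] reach_imp_open by (auto simp: open_edges_def)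
    then have "F \<subseteq> strong_cluster V \<omega> x"
      using F(2,3) branch_subset_V[OF edge_in_V(2)[OF xz]]
      by (auto simp: strong_cluster_def strongly_connected_in_def intro: converse_rtrancl_into_rtrancl)
    from card_mono[OF fin this] F(1) show False by simp
  qed
qed

section \<open>The percolation probability as a limit\<close>

text \<open>This equals \<open>1 - G (1 - s)\<close>, where \<open>G\<close> is the generating
  function of the state size.\<close>

definition root_prob :: "real \<Rightarrow> real" where
  "root_prob s = (\<Sum>i\<le>d. p i * (1 - (1 - s) ^ i))"

text \<open>The events that the origin reaches depth \<open>n\<close> decrease to the event of an
  infinite cluster, so continuity from above applies.\<close>

lemma root_prob_tendsto:
  assumes x: "x \<in> V"
  shows "(\<lambda>n. root_prob ((extend_prob ^^ n) edge_prob)) \<longlonglongrightarrow> strong_percolation_prob d V E x p"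
proof -
  define R where "R n = {\<omega> \<in> space P. \<exists>z\<in>\<omega> x. reach n x z \<omega>}" for n
  have "R n = (\<Union>z\<in>E `` {x}. {\<omega> \<in> space P. z \<in> \<omega> x} \<inter> {\<omega> \<in> space P. reach n x z \<omega>})" for n
    using config_subset[OF _ x] by (auto simp: R_def)
  moreover have "\<dots> n \<in> sets P" for n
    using finite_nbrs[OF x] x
    by (intro sets.finite_UN sets.Int measurable_coordinate measurable_reach) (auto dest: edge_in_V)
  ultimately have "range R \<subseteq> sets P" by auto
  moreover have "decseq R"
    unfolding decseq_Suc_iff R_def by (blast intro: reach_Suc_imp)
  ultimately have "(\<lambda>n. prob (R n)) \<longlonglongrightarrow> prob (\<Inter>n. R n)"
    by (rule finite_Lim_measure_decseq)
  moreover have "(\<Inter>n. R n) = {\<omega> \<in> space P. infinite (strong_cluster V \<omega> x)}"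
    using infinite_strong_cluster_iff[OF _ x] by (auto simp: R_def)
  moreover have "prob (R n) = root_prob ((extend_prob ^^ n) edge_prob)" for n
    unfolding R_def root_prob_def by (rule prob_root_reach[OF x])
  ultimately show ?thesis
    by (simp add: strong_percolation_prob_def)
qed

section \<open>Fixed points of \<open>extend_prob\<close> below and above the critical mean\<close>

definition mean_offspring :: real where
  "mean_offspring = (\<Sum>i\<le>d. p i * real (i - 1) * real i / real d)"

lemma edge_prob_bounds: "0 \<le> edge_prob" "edge_prob \<le> 1"
proof -
  show "0 \<le> edge_prob"
    unfolding edge_prob_def using p_nonneg by (intro sum_nonneg) auto
  have "edge_prob \<le> (\<Sum>i\<le>d. p i)"
    unfolding edge_prob_def
  proof (rule sum_mono)
    fix i assume "i \<in> {..d}"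
    then have "p i * (real i / real d) \<le> p i * 1"
      using d p_nonneg by (intro mult_left_mono) auto
    then show "p i * real i / real d \<le> p i" by simp
  qed
  then show "edge_prob \<le> 1" using sum_p by simp
qed

lemma extend_prob_mono:
  assumes "s \<le> t" "t \<le> 1"
  shows "extend_prob s \<le> extend_prob t"
  unfolding extend_prob_def using assms p_nonneg
  by (intro sum_mono divide_right_mono mult_right_mono mult_left_mono diff_left_mono power_mono) auto

lemma extend_prob_0: "extend_prob 0 = 0"
  by (simp add: extend_prob_def)

lemma extend_prob_le_1:
  assumes "s \<le> 1"
  shows "extend_prob s \<le> 1"
proof -
  have "extend_prob s \<le> edge_prob"
    unfolding extend_prob_def edge_prob_def using assms p_nonneg
    by (intro sum_mono divide_right_mono mult_right_mono mult_left_le) auto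
  then show ?thesis using edge_prob_bounds by simp
qed

lemma iterate_bounds: "(extend_prob ^^ n) edge_prob \<in> {0..1}"
proof (induction n)
  case (Suc n)
  then show ?case
    using extend_prob_mono[of 0 "(extend_prob ^^ n) edge_prob"] extend_prob_le_1 extend_prob_0 by auto
qed (use edge_prob_bounds in auto)

lemma extend_prob_le_linear:
  assumes "s \<le> 1"
  shows "extend_prob s \<le> mean_offspring * s"
proof -
  have "extend_prob s \<le> (\<Sum>i\<le>d. p i * (real (i - 1) * s) * real i / real d)"
    unfolding extend_prob_def using assms p_nonneg
    by (intro sum_mono divide_right_mono mult_right_mono mult_left_mono one_minus_power_le_linear) auto
  also have "\<dots> = mean_offspring * s"
    unfolding mean_offspring_def sum_distrib_right by (simp add: mult_ac)
  finally show ?thesis .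
qed

text \<open>If some size \<open>i \<ge> 3\<close> has positive probability, then
  \<open>i - 1 \<ge> 2\<close> and Bernoulli's inequality is strict in that term. Otherwise the mean
  is at most \<open>2 / 3\<close>.\<close>

lemma extend_prob_less:
  assumes "mean_offspring \<le> 1" "0 < s" "s \<le> 1"
  shows "extend_prob s < s"
proof (cases "\<exists>i\<in>{3..d}. p i > 0")
  case True
  then obtain i where i: "3 \<le> i" "i \<le> d" "p i > 0" by auto
  have "extend_prob s < (\<Sum>i\<le>d. p i * (real (i - 1) * s) * real i / real d)"
    unfolding extend_prob_def
  proof (rule sum_strict_mono_ex1)
    show "\<forall>i\<in>{..d}. p i * (1 - (1 - s) ^ (i - 1)) * real i / real d \<le> p i * (real (i - 1) * s) * real i / real d"
      using assms p_nonneg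
      by (intro ballI divide_right_mono mult_right_mono mult_left_mono one_minus_power_le_linear) auto
    show "\<exists>i\<in>{..d}. p i * (1 - (1 - s) ^ (i - 1)) * real i / real d < p i * (real (i - 1) * s) * real i / real d"
      using assms i d
      by (intro bexI[of _ i] divide_strict_right_mono mult_strict_right_mono mult_strict_left_mono
          one_minus_power_less_linear) auto
  qed simp
  also have "\<dots> = mean_offspring * s"
    unfolding mean_offspring_def sum_distrib_right by (simp add: mult_ac)
  also have "\<dots> \<le> 1 * s"
    using assms by (intro mult_right_mono) auto
  finally show ?thesis by simp
next
  case False
  \<comment> \<open>Only \<open>i = 2\<close> contributes, with factor \<open>2 / d\<close>, and
    \<open>d \<ge> 3\<close> bounds it. For \<open>d = 2\<close> and \<open>p 2 = 1\<close> one
    would have \<open>extend_prob s = s\<close>, so the strict inequality would fail.\<close>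
  have "mean_offspring \<le> (\<Sum>i\<le>d. p i * (2 / 3))"
    unfolding mean_offspring_def
  proof (rule sum_mono)
    fix i assume i: "i \<in> {..d}"
    show "p i * real (i - 1) * real i / real d \<le> p i * (2 / 3)"
    proof (cases "i \<ge> 3")
      case True
      then have "p i = 0" using False i p_nonneg[of i] by force
      then show ?thesis by simp
    next
      case False
      then consider "i = 0" | "i = 1" | "i = 2" by linarith
      then show ?thesis
        using d p_nonneg[of i] i by cases (auto simp: field_simps intro!: mult_right_mono)
    qed
  qed
  also have "\<dots> = 2 / 3"
    by (simp only: sum_distrib_right[symmetric] sum_p)
  finally have "mean_offspring * s \<le> 2 / 3 * s"
    using assms by (intro mult_right_mono) auto
  then show ?thesis using extend_prob_le_linear[OF assms(3)] assms(2) by linarith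
qed

text \<open>The iterates decrease to a fixed point of the continuous map \<open>extend_prob\<close>
  in the unit interval, and by \<open>extend_prob_less\<close> the only such point is 0.\<close>

lemma subcritical:
  assumes x: "x \<in> V" and m: "mean_offspring \<le> 1"
  shows "strong_percolation_prob d V E x p = 0"
proof -
  define a where "a n = (extend_prob ^^ n) edge_prob" for n
  have a01: "0 \<le> a n" "a n \<le> 1" for n
    using iterate_bounds[of n] by (auto simp: a_def)
  have "a (Suc n) \<le> a n" for n
    using extend_prob_less[OF m, of "a n"] extend_prob_0 a01[of n]
    by (cases "a n = 0") (auto simp: a_def)
  then have "decseq a" by (simp add: decseq_Suc_iff)
  then obtain l where l: "a \<longlonglongrightarrow> l" "\<And>n. l \<le> a n"
    by (rule decseq_convergent[of a 0]) (use a01 in blast)+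
  have l01: "0 \<le> l" "l \<le> 1"
    using LIMSEQ_le_const[OF l(1)] a01 l(2)[of 0] order_trans by blast+
  have "(\<lambda>n. extend_prob (a n)) \<longlonglongrightarrow> extend_prob l"
    unfolding extend_prob_def using l(1) d by (intro tendsto_intros) auto
  moreover have "(\<lambda>n. extend_prob (a n)) \<longlonglongrightarrow> l"
    using LIMSEQ_Suc[OF l(1)] by (simp add: a_def)
  ultimately have "extend_prob l = l" by (rule LIMSEQ_unique)
  then have "l = 0" using extend_prob_less[OF m, of l] l01 by force
  then have "(\<lambda>n. root_prob (a n)) \<longlonglongrightarrow> root_prob 0"
    unfolding root_prob_def using l(1) by (intro tendsto_intros) auto
  then have "(\<lambda>n. root_prob (a n)) \<longlonglongrightarrow> 0"
    by (simp add: root_prob_def)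
  with root_prob_tendsto[OF x] show ?thesis
    unfolding a_def by (rule LIMSEQ_unique)
qed

lemma extend_prob_has_derivative_0: "DERIV extend_prob 0 :> mean_offspring"
  unfolding extend_prob_def mean_offspring_def
proof (rule DERIV_sum)
  fix i
  have "((\<lambda>s. 1 - (1 - s) ^ (i - 1)) has_real_derivative real (i - 1)) (at 0)"
    by (auto intro!: derivative_eq_intros)
  from DERIV_cmult[OF this, of "p i * real i / real d"]
  show "((\<lambda>s. p i * (1 - (1 - s) ^ (i - 1)) * real i / real d) has_real_derivative
      p i * real (i - 1) * real i / real d) (at 0)"
    by (simp add: mult_ac)
qed

lemma supercritical:
  assumes x: "x \<in> V" and m: "mean_offspring > 1"
  shows "strong_percolation_prob d V E x p > 0"
proof -
  \<comment> \<open>Sizes 0 and 1 add nothing to the mean, so some size at least 2 has positive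
    probability. It makes both \<open>edge_prob\<close> and \<open>root_prob \<epsilon>\<close>
    positive.\<close>
  obtain i where i: "i \<le> d" "2 \<le> i" "p i > 0"
  proof -
    have "\<exists>i\<in>{..d}. p i * real (i - 1) * real i / real d \<noteq> 0"
    proof (rule ccontr)
      assume "\<not> ?thesis"
      then have "mean_offspring = 0"
        unfolding mean_offspring_def by (intro sum.neutral) blast
      with m show False by simp
    qed
    then obtain i where "i \<le> d" "p i \<noteq> 0" "i - 1 \<noteq> 0" by auto
    then show thesis using that[of i] p_nonneg[of i] by auto
  qed
  have "edge_prob > 0"
    unfolding edge_prob_def using i d p_nonneg by (intro sum_pos2[of _ i]) auto
  have "DERIV (\<lambda>s. extend_prob s - s) 0 :> mean_offspring - 1"
    by (auto intro!: derivative_eq_intros extend_prob_has_derivative_0)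
  from DERIV_pos_inc_right[OF this] m obtain \<delta> where \<delta>: "\<delta> > 0"
      "\<And>h. 0 < h \<Longrightarrow> h < \<delta> \<Longrightarrow> 0 < extend_prob h - h"
    using extend_prob_0 by auto
  \<comment> \<open>The bound by \<open>edge_prob\<close> starts the induction over the iterates;
    halving \<open>\<delta>\<close> keeps \<open>\<epsilon>\<close> strictly inside the interval
    where \<open>extend_prob h > h\<close>.\<close>
  define \<epsilon> where "\<epsilon> = min edge_prob (\<delta> / 2)"
  have \<epsilon>: "0 < \<epsilon>" "\<epsilon> \<le> edge_prob" "\<epsilon> \<le> extend_prob \<epsilon>"
    using \<delta>(1) \<delta>(2)[of \<epsilon>] \<open>edge_prob > 0\<close> by (auto simp: \<epsilon>_def min_def)
  then have "\<epsilon> \<le> 1" using edge_prob_bounds by simp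
  have "\<epsilon> \<le> (extend_prob ^^ n) edge_prob" for n
  proof (induction n)
    case (Suc n)
    then have "extend_prob \<epsilon> \<le> (extend_prob ^^ Suc n) edge_prob"
      using extend_prob_mono iterate_bounds[of n] by auto
    with \<epsilon>(3) show ?case by simp
  qed (use \<epsilon> in simp)
  then have "root_prob \<epsilon> \<le> root_prob ((extend_prob ^^ n) edge_prob)" for n
    unfolding root_prob_def using p_nonneg iterate_bounds[of n]
    by (intro sum_mono mult_left_mono diff_left_mono power_mono) auto
  then have "root_prob \<epsilon> \<le> strong_percolation_prob d V E x p"
    by (intro LIMSEQ_le_const[OF root_prob_tendsto[OF x]]) auto
  moreover have "root_prob \<epsilon> > 0"
    unfolding root_prob_def
  proof (rule sum_pos2)
    have "(1 - \<epsilon>) ^ i \<le> (1 - \<epsilon>) ^ 1"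
      using i \<epsilon> \<open>\<epsilon> \<le> 1\<close> by (intro power_decreasing) auto
    then show "0 < p i * (1 - (1 - \<epsilon>) ^ i)" using i \<epsilon> by simp
    show "0 \<le> p j * (1 - (1 - \<epsilon>) ^ j)" if "j \<in> {..d}" for j
      using that p_nonneg \<epsilon> \<open>\<epsilon> \<le> 1\<close> by (intro mult_nonneg_nonneg) (auto intro: power_le_one)
  qed (use i in auto)
  ultimately show ?thesis by simp
qed

section \<open>The percolation criterion and its two instances\<close>

lemma strong_percolation_pos_iff:
  assumes "x \<in> V"
  shows "strong_percolation_prob d V E x p > 0 \<longleftrightarrow> (\<Sum>i\<le>d. p i * (real i * (real i - 1))) > real d"
proof -
  have "mean_offspring = (\<Sum>i\<le>d. p i * (real i * (real i - 1)) / real d)"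
    unfolding mean_offspring_def
  proof (rule sum.cong)
    fix i
    show "p i * real (i - 1) * real i / real d = p i * (real i * (real i - 1)) / real d"
      by (cases i) auto
  qed simp
  then have "mean_offspring = (\<Sum>i\<le>d. p i * (real i * (real i - 1))) / real d"
    by (simp add: sum_divide_distrib)
  then have "mean_offspring > 1 \<longleftrightarrow> (\<Sum>i\<le>d. p i * (real i * (real i - 1))) > real d"
    using d by (simp add: less_divide_eq_1_pos)
  then show ?thesis
    using subcritical[OF assms] supercritical[OF assms] by force
qed

end

theorem theorem4:
  fixes d k :: nat and V :: "'v set" and E :: "'v rel" and orig :: 'v
  assumes "d \<ge> 3"
    and "regular_tree d V E"
    and "orig \<in> V"
    and "2 \<le> k" and "k \<le> d - 1"
  shows "(\<forall>(pp :: nat \<Rightarrow> real) (p :: real).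
            0 \<le> p \<and> p \<le> 1 \<and> prob_vector d pp \<and>
            pp k = 1 - p \<and> pp (k + 1) = p \<and> (\<forall>i\<le>d. i \<noteq> k \<and> i \<noteq> k + 1 \<longrightarrow> pp i = 0) \<longrightarrow>
            (strong_percolation_prob d V E orig pp > 0 \<longleftrightarrow>
             p > (real d - real k * (real k - 1)) / (2 * real k)))
       \<and> (k * (k - 1) \<le> d \<and> d < (k + 1) * k \<longrightarrow>
            (\<forall>pp :: nat \<Rightarrow> real. prob_vector d pp \<longrightarrow>
              ((\<Sum>i\<le>k. pp i) = 1 \<longrightarrow> strong_percolation_prob d V E orig pp = 0) \<and>
              ((\<Sum>i=k+1..d. pp i) = 1 \<longrightarrow> strong_percolation_prob d V E orig pp > 0)))"
proof (intro conjI allI impI; elim conjE)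
  note kd = assms(4,5)
  have pos_iff: "strong_percolation_prob d V E orig pp > 0 \<longleftrightarrow>
      (\<Sum>i\<le>d. pp i * (real i * (real i - 1))) > real d" if "prob_vector d pp" for pp
    using percolation_tree.strong_percolation_pos_iff[of d V E pp orig] assms that
    by (simp add: percolation_tree_def)
  {
    fix pp :: "nat \<Rightarrow> real" and p :: real
    assume pv: "prob_vector d pp" and pp: "pp k = 1 - p" "pp (k + 1) = p"
      and 0: "\<forall>i\<le>d. i \<noteq> k \<and> i \<noteq> k + 1 \<longrightarrow> pp i = 0"
    have "(\<Sum>i\<le>d. pp i * (real i * (real i - 1))) = (\<Sum>i\<in>{k, k + 1}. pp i * (real i * (real i - 1)))"
      using kd 0 by (intro sum.mono_neutral_right) auto
    also have "\<dots> = (1 - p) * (real k * (real k - 1)) + p * (real (k + 1) * (real (k + 1) - 1))"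
      using pp by simp
    \<comment> \<open>The values of \<open>i * (i - 1)\<close> at \<open>k + 1\<close> and
      \<open>k\<close> differ by \<open>2 * k\<close>, which is the denominator of the
      threshold.\<close>
    also have "\<dots> = real k * (real k - 1) + 2 * real k * p"
      by (simp add: algebra_simps)
    finally have "strong_percolation_prob d V E orig pp > 0 \<longleftrightarrow> real d < real k * (real k - 1) + 2 * real k * p"
      using pos_iff[OF pv] by simp
    also have "\<dots> \<longleftrightarrow> p > (real d - real k * (real k - 1)) / (2 * real k)"
      using kd by (simp add: field_simps)
    finally show "strong_percolation_prob d V E orig pp > 0 \<longleftrightarrow>
        p > (real d - real k * (real k - 1)) / (2 * real k)" .
  next
    fix pp :: "nat \<Rightarrow> real"
    assume kk: "k * (k - 1) \<le> d" and pv: "prob_vector d pp" and 1: "(\<Sum>i\<le>k. pp i) = 1"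
    have nn: "i \<le> d \<Longrightarrow> 0 \<le> pp i" for i using pv by (auto simp: prob_vector_def)
    have "{..d} = {..k} \<union> {k+1..d}" using kd by auto
    then have "(\<Sum>i\<le>d. pp i) = (\<Sum>i\<le>k. pp i) + (\<Sum>i=k+1..d. pp i)"
      by (simp add: sum.union_disjoint)
    then have "(\<Sum>i=k+1..d. pp i) = 0" using pv 1 by (simp add: prob_vector_def)
    then have 0: "pp i = 0" if "i \<in> {k+1..d}" for i
      using that nn by (subst (asm) sum_nonneg_eq_0_iff) auto
    \<comment> \<open>All mass sits on sizes at most \<open>k\<close>, where
      \<open>i * (i - 1)\<close> is largest at \<open>i = k\<close>.\<close>
    have "(\<Sum>i\<le>d. pp i * (real i * (real i - 1))) \<le> (\<Sum>i\<le>d. pp i * (real k * (real k - 1)))"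
    proof (rule sum_mono)
      fix i assume i: "i \<in> {..d}"
      show "pp i * (real i * (real i - 1)) \<le> pp i * (real k * (real k - 1))"
      proof (cases "i \<le> k")
        case True
        then show ?thesis
          using nn i kd by (cases "i = 0") (auto intro!: mult_left_mono mult_mono)
      qed (use 0 i in auto)
    qed
    also have "\<dots> = real k * (real k - 1)"
      using pv by (simp add: sum_distrib_right[symmetric] prob_vector_def)
    also have "\<dots> = real (k * (k - 1))"
      using kd by (simp add: of_nat_diff)
    \<comment> \<open>Equality is allowed, since the criterion is strict: the critical process dies
      out.\<close>
    also have "\<dots> \<le> real d" using kk by linarith
    finally show "strong_percolation_prob d V E orig pp = 0"
      using pos_iff[OF pv] by (simp add: strong_percolation_prob_def order_less_le)
  next
    fix pp :: "nat \<Rightarrow> real"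
    assume kk: "d < (k + 1) * k" and pv: "prob_vector d pp" and 1: "(\<Sum>i=k+1..d. pp i) = 1"
    have nn: "i \<le> d \<Longrightarrow> 0 \<le> pp i" for i using pv by (auto simp: prob_vector_def)
    \<comment> \<open>On sizes at least \<open>k + 1\<close> the weight \<open>i * (i - 1)\<close>
      is at least \<open>(k + 1) * k\<close>, which exceeds \<open>d\<close>.\<close>
    have "real d < real ((k + 1) * k)" using kk by linarith
    also have "\<dots> = (\<Sum>i=k+1..d. pp i) * (real (k + 1) * real k)"
      unfolding 1 by (simp only: of_nat_mult mult_1)
    also have "\<dots> = (\<Sum>i=k+1..d. pp i * (real (k + 1) * real k))"
      by (rule sum_distrib_right)
    also have "\<dots> \<le> (\<Sum>i=k+1..d. pp i * (real i * (real i - 1)))"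
      using nn by (intro sum_mono mult_left_mono mult_mono) auto
    also have "\<dots> \<le> (\<Sum>i\<le>d. pp i * (real i * (real i - 1)))"
    proof (rule sum_mono2)
      show "0 \<le> pp i * (real i * (real i - 1))" if "i \<in> {..d} - {k+1..d}" for i
        using that nn by (cases "i = 0") auto
    qed auto
    finally show "strong_percolation_prob d V E orig pp > 0"
      using pos_iff[OF pv] by simp
  }
qed

end
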